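(* Let $G$ be a triangle-free graph on $n$ vertices. Then the following hold. (i) If $\delta_2(G)>\lfloor \frac{n}{5}\rfloor$ and $n\geq 5$, then $G$ is bipartite. (ii) If $\delta_2(G)>\lfloor \frac{n}{8}\rfloor$ and $n\geq 8$, then $G$ is homomorphic to $C_5$.
   Context: Graphs are finite and simple. For a vertex $x$ of $G$, $N(x)=\{y\in V(G)\colon xy\in E(G)\}$. The minimum common degree $\delta_2(G)$ is the minimum of $|N(x)\cap N(y)|$ over all non-edges $xy$ of $G$, i.e. over all pairs of distinct non-adjacent vertices $x,y$. $C_5$ is the cycle of length 5. A graph $G$ is homomorphic to a graph $H$ if there is a map $\sigma\colon V(G)\to V(H)$ such that $\sigma(u)\sigma(v)\in E(H)$ for every $uv\in E(G)$. *)

theory Defs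
  imports "Graph_Theory.Pair_Digraph" "HOL-Library.FuncSet"
begin

text \<open>
  Finite simple graphs are rendered by the locale \<^locale>\<open>pair_graph\<close>: a finite, symmetric,
  loop-free digraph whose arcs are pairs of vertices. An undirected edge \<open>xy\<close> is thus the pair
  of arcs \<open>(x, y)\<close> and \<open>(y, x)\<close>.
\<close>

definition neighbourhood :: "'a pair_pre_digraph \<Rightarrow> 'a \<Rightarrow> 'a set" where
  "neighbourhood G x = {y \<in> pverts G. (x, y) \<in> parcs G}"

definition nonedges :: "'a pair_pre_digraph \<Rightarrow> ('a \<times> 'a) set" where
  "nonedges G = {(x, y). x \<in> pverts G \<and> y \<in> pverts G \<and> x \<noteq> y \<and> (x, y) \<notin> parcs G}"

text \<open>
  The minimum is unspecified for complete graphs, which have no non-edges. A triangle-free graph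
  on at least three vertices always has one.
\<close>

definition min_common_degree :: "'a pair_pre_digraph \<Rightarrow> nat" where
  "min_common_degree G =
     Min ((\<lambda>(x, y). card (neighbourhood G x \<inter> neighbourhood G y)) ` nonedges G)"

text \<open>The vertices of a triangle are distinct automatically, there being no loops.\<close>

definition triangle_free :: "'a pair_pre_digraph \<Rightarrow> bool" where
  "triangle_free G \<longleftrightarrow>
     \<not> (\<exists>x y z. (x, y) \<in> parcs G \<and> (y, z) \<in> parcs G \<and> (z, x) \<in> parcs G)"

definition bipartite_graph :: "'a pair_pre_digraph \<Rightarrow> bool" where
  "bipartite_graph G \<longleftrightarrow>
     (\<exists>A B. pverts G = A \<union> B \<and> A \<inter> B = {} \<and>
        (\<forall>(u, v) \<in> parcs G. (u \<in> A \<and> v \<in> B) \<or> (u \<in> B \<and> v \<in> A)))"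

definition homomorphic :: "'a pair_pre_digraph \<Rightarrow> 'b pair_pre_digraph \<Rightarrow> bool" where
  "homomorphic G H \<longleftrightarrow>
     (\<exists>\<sigma> \<in> pverts G \<rightarrow> pverts H. \<forall>(u, v) \<in> parcs G. (\<sigma> u, \<sigma> v) \<in> parcs H)"

text \<open>This is the cycle of length \<open>k\<close> only for \<open>k \<ge> 3\<close>.\<close>

definition cycle_graph :: "nat \<Rightarrow> nat pair_pre_digraph" where
  "cycle_graph k =
     \<lparr> pverts = {..<k},
       parcs = {(i, j). i < k \<and> j < k \<and> (j = (i + 1) mod k \<or> i = (j + 1) mod k)} \<rparr>"

lemma pair_graph_cycle_graph:
  assumes "k \<ge> 3"
  shows "pair_graph (cycle_graph k)"
proof -
  have "finite (parcs (cycle_graph k))"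
    by (rule finite_subset[of _ "{..<k} \<times> {..<k}"]) (auto simp: cycle_graph_def)
  moreover have "Suc i mod k \<noteq> i" "i \<noteq> Suc i mod k" if "i < k" for i
    using that assms by (cases "Suc i = k"; auto)+
  ultimately show ?thesis
    by unfold_locales (auto simp: cycle_graph_def symmetric_def sym_def)
qed

end

theory Submission
  imports Defs
begin

text \<open>
  In a triangle-free graph a vertex sees at most two vertices of a five-cycle, so the common
  neighbourhoods of the five non-adjacent pairs of a five-cycle are disjoint. As the diameter is
  at most two, a non-bipartite graph contains a five-cycle, which gives (i).

  For (ii), the vertices seeing two vertices of a five-cycle \<open>C\<close> are mapped to \<open>C\<close> in the obvious
  way, so it suffices that there are no others. The eight pairs at distance two on the rim of a
  Wagner graph have disjoint common neighbourhoods, so there is no Wagner graph. If \<open>u\<close> sees only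
  the vertex \<open>v0\<close> of \<open>C\<close>, the absence of Wagner graphs forces many vertices that see only \<open>v2\<close>
  or many that see only \<open>v3\<close>; repeating this yields two large classes of such vertices at
  distance two on \<open>C\<close>, and from these again eight non-adjacent pairs with disjoint common
  neighbourhoods. Finally, if \<open>u\<close> sees no vertex of \<open>C\<close>, exchanging a vertex of \<open>C\<close> for a
  neighbour of \<open>u\<close> turns \<open>u\<close> into a vertex that sees exactly one.
\<close>

section \<open>Counting disjoint sets, colourings and common neighbours\<close>

lemma card_Union_ge_if_disjoint:
  assumes "sorted_wrt disjnt Ss" "\<And>S. S \<in> set Ss \<Longrightarrow> finite S \<and> t \<le> card S"
  shows "length Ss * t \<le> card (\<Union>(set Ss))"
  using assms
proof (induction Ss)
  case (Cons S Ss)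
  have "S \<inter> \<Union>(set Ss) = {}" using Cons.prems(1) by (auto simp: disjnt_def)
  then have "card (S \<union> \<Union>(set Ss)) = card S + card (\<Union>(set Ss))"
    using Cons.prems(2) by (intro card_Un_disjoint) auto
  moreover have "length Ss * t \<le> card (\<Union>(set Ss))" using Cons by auto
  ultimately show ?case using Cons.prems(2)[of S] by simp
qed simp

lemma homomorphic_cycle_graph_5_if_bipartite:
  assumes "bipartite_graph G" shows "homomorphic G (cycle_graph 5)"
proof -
  obtain A B where AB: "pverts G = A \<union> B" "A \<inter> B = {}"
    "\<forall>(u, v) \<in> parcs G. (u \<in> A \<and> v \<in> B) \<or> (u \<in> B \<and> v \<in> A)"
    using assms unfolding bipartite_graph_def by blast
  show ?thesis unfolding homomorphic_def
  proof (intro bexI[of _ "\<lambda>u. if u \<in> A then 0 else 1 :: nat"])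
    show "\<forall>(u, v)\<in>parcs G. (if u \<in> A then 0 else 1 :: nat, if v \<in> A then 0 else 1)
        \<in> parcs (cycle_graph 5)"
      using AB by (fastforce simp: cycle_graph_def)
  qed (auto simp: cycle_graph_def)
qed

text \<open>One setting for both parts: \<open>t\<close> becomes \<open>Suc (n div 5)\<close> or
  \<open>Suc (n div 8)\<close>. The bound \<open>order_less\<close> also makes \<open>t\<close>
  positive, so distinct non-adjacent vertices have a common neighbour.\<close>

locale common_degree_graph = pair_graph G for G :: "'a pair_pre_digraph" +
  fixes t :: nat
  assumes tri_free: "triangle_free G"
    and common: "(x, y) \<in> nonedges G \<Longrightarrow> t \<le> card (neighbourhood G x \<inter> neighbourhood G y)"
    and order_less: "card (pverts G) < 8 * t"
begin

abbreviation E where "E x y \<equiv> (x, y) \<in> parcs G"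
abbreviation N where "N \<equiv> neighbourhood G"

lemma E_sym: "E x y \<Longrightarrow> E y x"
  using arcs_symmetric by auto

lemma E_verts: "E x y \<Longrightarrow> x \<in> pverts G" "E x y \<Longrightarrow> y \<in> pverts G"
  using in_arcsD1 in_arcsD2 by auto

lemma N_iff [simp]: "z \<in> N x \<longleftrightarrow> E x z"
  unfolding neighbourhood_def using E_verts by auto

lemma no_triangle: "E x y \<Longrightarrow> E x z \<Longrightarrow> E y z \<Longrightarrow> False"
  using tri_free E_sym unfolding triangle_free_def by blast

lemma N_subset: "N x \<subseteq> pverts G"
  unfolding neighbourhood_def by auto

lemma t_pos: "t > 0"
  using order_less by (cases t) auto

lemma common_ge:
  assumes "x \<in> pverts G" "y \<in> pverts G" "x \<noteq> y" "\<not> E x y"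
  shows "t \<le> card (N x \<inter> N y)"
  using common[of x y] assms unfolding nonedges_def by auto

lemma common_neighbour:
  assumes "x \<in> pverts G" "y \<in> pverts G" "x \<noteq> y" "\<not> E x y"
  obtains z where "E x z" "E y z"
proof -
  have "card (N x \<inter> N y) > 0" using common_ge[OF assms] t_pos by simp
  then have "N x \<inter> N y \<noteq> {}" using card_gt_0_iff by blast
  then show ?thesis using that by auto
qed

lemma disjoint_large_sets:
  assumes "sorted_wrt disjnt Ss" "\<And>S. S \<in> set Ss \<Longrightarrow> S \<subseteq> pverts G" "\<And>S. S \<in> set Ss \<Longrightarrow> t \<le> card S"
  shows "length Ss * t \<le> card (pverts G)"
proof -
  have "length Ss * t \<le> card (\<Union>(set Ss))"
    using assms finite_subset[OF _ finite_verts]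
    by (intro card_Union_ge_if_disjoint) auto
  also have "\<dots> \<le> card (pverts G)" using assms by (intro card_mono) auto
  finally show ?thesis .
qed

lemma no_eight_disjoint_large_sets:
  assumes "sorted_wrt disjnt Ss" "length Ss = 8"
    "\<And>S. S \<in> set Ss \<Longrightarrow> S \<subseteq> pverts G" "\<And>S. S \<in> set Ss \<Longrightarrow> t \<le> card S"
  shows False
  using disjoint_large_sets[OF assms(1,3,4)] assms(2) order_less by simp

section \<open>Five-cycles, part (i) and the Wagner graph\<close>

definition five_cycle :: "'a \<Rightarrow> 'a \<Rightarrow> 'a \<Rightarrow> 'a \<Rightarrow> 'a \<Rightarrow> bool" where
  "five_cycle a b c d e \<longleftrightarrow> E a b \<and> E b c \<and> E c d \<and> E d e \<and> E e a"

lemma five_cycle_rotate: "five_cycle a b c d e \<Longrightarrow> five_cycle b c d e a"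
  unfolding five_cycle_def by auto

lemma five_cycle_reflect: "five_cycle a b c d e \<Longrightarrow> five_cycle a e d c b"
  unfolding five_cycle_def using E_sym by auto

text \<open>A chord \<open>ac\<close> closes a triangle with \<open>b\<close>, and
  \<open>a = c\<close> closes one with \<open>d\<close> and \<open>e\<close>. Hence the closed walk
  in \<open>five_cycle\<close> has distinct vertices.\<close>

lemma five_cycle_chord:
  assumes "five_cycle a b c d e"
  shows "\<not> E a c" "\<not> E c a" "a \<noteq> c"
  using assms no_triangle E_sym unfolding five_cycle_def by blast+

lemma five_cycle_common_ge:
  assumes "five_cycle a b c d e" shows "t \<le> card (N a \<inter> N c)"
  using assms five_cycle_chord[OF assms]
  by (intro common_ge) (auto simp: five_cycle_def dest: E_verts)

text \<open>Unless \<open>N v\<close> and its complement are colour classes, some edge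
  \<open>xy\<close> has both ends on one side; without triangles this is the side outside
  \<open>N v\<close>. Common neighbours of \<open>v\<close> with \<open>x\<close> and with
  \<open>y\<close> then close a five-cycle.\<close>

lemma bipartite_or_five_cycle:
  assumes "\<not> bipartite_graph G" obtains a b c d e where "five_cycle a b c d e"
proof -
  have "pverts G \<noteq> {}"
    using assms E_verts unfolding bipartite_graph_def by fastforce
  then obtain v where v: "v \<in> pverts G" by blast
  have "\<exists>(x, y) \<in> parcs G. \<not> (x \<in> N v \<and> y \<in> pverts G - N v \<or> x \<in> pverts G - N v \<and> y \<in> N v)"
  proof (rule ccontr)
    assume "\<not> ?thesis"
    then have "bipartite_graph G" unfolding bipartite_graph_def using N_subset
      by (intro exI[of _ "N v"] exI[of _ "pverts G - N v"]) auto
    then show False using assms by simp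
  qed
  then obtain x y where xy: "E x y"
    and "\<not> (x \<in> N v \<and> y \<in> pverts G - N v \<or> x \<in> pverts G - N v \<and> y \<in> N v)"
    by blast
  then have "E v x \<longleftrightarrow> E v y" using E_verts[OF xy] by auto
  then have nxy: "\<not> E v x" "\<not> E v y" using no_triangle[of v x y] xy by blast+
  then have "x \<noteq> v" "y \<noteq> v" using E_sym xy by auto
  obtain p where p: "E v p" "E x p"
    using common_neighbour[of v x] v xy nxy \<open>x \<noteq> v\<close> E_verts by metis
  obtain q where q: "E v q" "E y q"
    using common_neighbour[of v y] v xy nxy \<open>y \<noteq> v\<close> E_verts by metis
  have "five_cycle v p x y q"
    using p q xy E_sym unfolding five_cycle_def by auto
  then show ?thesis by (rule that)
qed

lemma bipartite_if_order_less:
  assumes "card (pverts G) < 5 * t" shows "bipartite_graph G"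
proof (rule ccontr)
  assume "\<not> bipartite_graph G"
  then obtain a b c d e where C: "five_cycle a b c d e" by (rule bipartite_or_five_cycle)
  note C1 = five_cycle_rotate[OF C]
  note C2 = five_cycle_rotate[OF C1]
  note C3 = five_cycle_rotate[OF C2]
  note C4 = five_cycle_rotate[OF C3]
  let ?Ss = "[N a \<inter> N c, N b \<inter> N d, N c \<inter> N e, N d \<inter> N a, N e \<inter> N b]"
  have E: "E a b" "E b c" "E c d" "E d e" "E e a"
    using C unfolding five_cycle_def by auto
  \<comment> \<open>Two distinct pairs at distance two on the cycle together contain an edge, so a
    vertex in both sets would lie in a triangle.\<close>
  have "sorted_wrt disjnt ?Ss"
    by (auto simp: disjnt_iff dest: E[THEN no_triangle])
  then have "length ?Ss * t \<le> card (pverts G)"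
    using C C1 C2 C3 C4 five_cycle_common_ge N_subset
    by (intro disjoint_large_sets) (auto dest: E_verts)
  then show False using assms by simp
qed

text \<open>Rim indices differing by 1 or 4 modulo 8 give edges, and any two of the eight pairs
  contain such indices. Each spoke closes a rim path of four edges to a five-cycle, so each pair has
  at least \<open>t\<close> common neighbours.\<close>

lemma no_wagner_graph:
  assumes "E x0 x1" "E x1 x2" "E x2 x3" "E x3 x4" "E x4 x5" "E x5 x6" "E x6 x7" "E x7 x0"
    "E x0 x4" "E x1 x5" "E x2 x6" "E x3 x7"
  shows False
proof -
  let ?Ss = "[N x0 \<inter> N x2, N x1 \<inter> N x3, N x2 \<inter> N x4, N x3 \<inter> N x5,
    N x4 \<inter> N x6, N x5 \<inter> N x7, N x6 \<inter> N x0, N x7 \<inter> N x1]"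
  note E = assms assms[THEN E_sym]
  have disj: "sorted_wrt disjnt ?Ss"
    by (auto simp: disjnt_iff dest: E[THEN no_triangle])
  have "t \<le> card (N x0 \<inter> N x2)" "t \<le> card (N x1 \<inter> N x3)" "t \<le> card (N x2 \<inter> N x4)"
    "t \<le> card (N x3 \<inter> N x5)" "t \<le> card (N x4 \<inter> N x6)" "t \<le> card (N x5 \<inter> N x7)"
    "t \<le> card (N x6 \<inter> N x0)" "t \<le> card (N x7 \<inter> N x1)"
    using five_cycle_common_ge[of x0 x1 x2 x3 x4] five_cycle_common_ge[of x1 x2 x3 x4 x5]
      five_cycle_common_ge[of x2 x3 x4 x5 x6] five_cycle_common_ge[of x3 x4 x5 x6 x7]
      five_cycle_common_ge[of x4 x5 x6 x7 x0] five_cycle_common_ge[of x5 x6 x7 x0 x1]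
      five_cycle_common_ge[of x6 x7 x0 x1 x2] five_cycle_common_ge[of x7 x0 x1 x2 x3] E
    by (auto simp: five_cycle_def)
  then show False
    using N_subset by (intro no_eight_disjoint_large_sets[OF disj]) auto
qed

section \<open>Vertices seeing exactly one vertex of a five-cycle\<close>

text \<open>
  If \<open>c\<close> and \<open>d\<close> are the two vertices of a five-cycle opposite to \<open>a\<close>, this is the set of
  vertices that see only \<open>a\<close> on the cycle.
\<close>

definition exclusive :: "'a \<Rightarrow> 'a \<Rightarrow> 'a \<Rightarrow> 'a set" where
  "exclusive a c d = N a - (N c \<union> N d)"

lemma exclusive_commute: "exclusive a c d = exclusive a d c"
  unfolding exclusive_def by auto

lemma exclusive_iff: "z \<in> exclusive a c d \<longleftrightarrow> E a z \<and> \<not> E c z \<and> \<not> E d z"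
  unfolding exclusive_def by auto

lemma exclusive_subset: "exclusive a c d \<subseteq> pverts G"
  using N_subset unfolding exclusive_def by auto

lemma finite_exclusive: "finite (exclusive a c d)"
  using exclusive_subset finite_subset[OF _ finite_verts] by blast

lemma exclusive_nonempty:
  assumes "t \<le> card (exclusive a c d)" obtains z where "z \<in> exclusive a c d"
  using assms t_pos by (cases "exclusive a c d = {}") auto

lemma exclusive_common_ge:
  assumes "five_cycle a b c d e" "u \<in> exclusive a c d"
  shows "t \<le> card (N u \<inter> N c)" "t \<le> card (N u \<inter> N d)" "t \<le> card (N u \<inter> N e)"
proof -
  have "u \<noteq> c" "u \<noteq> d" "u \<noteq> e" "\<not> E u c" "\<not> E u d" "\<not> E u e"
    using assms no_triangle E_sym unfolding five_cycle_def exclusive_iff by blast+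
  then show "t \<le> card (N u \<inter> N c)" "t \<le> card (N u \<inter> N d)" "t \<le> card (N u \<inter> N e)"
    using assms unfolding five_cycle_def exclusive_iff by (auto intro!: common_ge dest: E_verts)
qed

text \<open>A common neighbour of \<open>u\<close> and \<open>c\<close> misses \<open>e\<close> by
  assumption and \<open>a\<close> because \<open>au\<close> is an edge.\<close>

lemma exclusive_large_if_no_neighbour:
  assumes "five_cycle a b c d e" "u \<in> exclusive a c d" "N u \<inter> N c \<inter> N e = {}"
  shows "N u \<inter> N c \<subseteq> exclusive c e a" "t \<le> card (exclusive c e a)"
proof -
  show sub: "N u \<inter> N c \<subseteq> exclusive c e a"
  proof
    fix z assume z: "z \<in> N u \<inter> N c"
    then have "\<not> E e z" using assms(3) by auto
    moreover have "\<not> E a z" using no_triangle[of a u z] z assms(2) exclusive_iff by auto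
    ultimately show "z \<in> exclusive c e a" using z exclusive_iff by auto
  qed
  show "t \<le> card (exclusive c e a)"
    using exclusive_common_ge(1)[OF assms(1,2)] card_mono[OF finite_exclusive sub] by simp
qed

lemma exclusive_no_neighbour:
  assumes "five_cycle a b c d e" "u \<in> exclusive a c d"
  shows "N u \<inter> N c \<inter> N e = {} \<or> N u \<inter> N d \<inter> N b = {}"
proof (rule ccontr)
  assume "\<not> ?thesis"
  then obtain w w' where "E u w" "E c w" "E e w" "E u w'" "E d w'" "E b w'" by auto
  \<comment> \<open>On the rim \<open>d e a b c w u w'\<close> the spokes are \<open>dc\<close>,
    \<open>ew\<close>, \<open>au\<close> and \<open>bw'\<close>.\<close>
  then show False
    using no_wagner_graph[of d e a b c w u w'] assms E_sym
    unfolding five_cycle_def exclusive_iff by blast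
qed

lemma exclusive_large_step:
  assumes "five_cycle a b c d e" "u \<in> exclusive a c d"
  shows "t \<le> card (exclusive c e a) \<or> t \<le> card (exclusive d a b)"
proof -
  have u: "u \<in> exclusive a d c" using assms(2) exclusive_commute by metis
  show ?thesis
    using exclusive_no_neighbour[OF assms] exclusive_large_if_no_neighbour(2)[OF assms]
      exclusive_large_if_no_neighbour(2)[OF five_cycle_reflect[OF assms(1)] u]
    unfolding exclusive_commute[of d b a] by blast
qed

text \<open>Members of the three classes see just one vertex of the cycle. Together with the five
  common neighbourhoods the classes would give eight disjoint large sets.\<close>

lemma not_three_exclusive_large:
  assumes C: "five_cycle a b c d e" and "t \<le> card (exclusive a c d)" "t \<le> card (exclusive c e a)"
  shows "card (exclusive d a b) < t"
proof (rule ccontr)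
  assume large: "\<not> card (exclusive d a b) < t"
  note C1 = five_cycle_rotate[OF C]
  note C2 = five_cycle_rotate[OF C1]
  note C3 = five_cycle_rotate[OF C2]
  note C4 = five_cycle_rotate[OF C3]
  let ?Ss = "[N a \<inter> N c, N b \<inter> N d, N c \<inter> N e, N d \<inter> N a, N e \<inter> N b,
    exclusive a c d, exclusive c e a, exclusive d a b]"
  have E: "E a b" "E b c" "E c d" "E d e" "E e a" "E b a" "E c b" "E d c" "E e d" "E a e"
    using C E_sym unfolding five_cycle_def by auto
  have disj: "sorted_wrt disjnt ?Ss"
    by (auto simp: disjnt_iff exclusive_iff dest: E[THEN no_triangle])
  then show False
    using assms large C C1 C2 C3 C4 five_cycle_common_ge subsetD[OF N_subset]
      subsetD[OF exclusive_subset]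
    by (intro no_eight_disjoint_large_sets[OF disj]) auto
qed

lemma not_two_exclusive_large:
  assumes C: "five_cycle a b c d e" and large: "t \<le> card (exclusive a c d)" "t \<le> card (exclusive c e a)"
  shows False
proof -
  \<comment> \<open>The reflection fixing \<open>b\<close> swaps \<open>a\<close> with
    \<open>c\<close> and \<open>d\<close> with \<open>e\<close>.\<close>
  have C': "five_cycle c b a e d"
    using C E_sym unfolding five_cycle_def by auto
  have small_d: "card (exclusive d a b) < t" using not_three_exclusive_large[OF C large] .
  have small_e: "card (exclusive e c b) < t"
    using not_three_exclusive_large[OF C'] large exclusive_commute by metis
  obtain u where u: "u \<in> exclusive a c d" using exclusive_nonempty[OF large(1)] .
  \<comment> \<open>Were this empty, the class at \<open>d\<close> would be large, against
    \<open>small_d\<close>.\<close>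
  have "N u \<inter> N d \<inter> N b \<noteq> {}"
    using exclusive_large_if_no_neighbour(2)[OF five_cycle_reflect[OF C], of u] u small_d
      exclusive_commute by fastforce
  then have u_no: "N u \<inter> N c \<inter> N e = {}" using exclusive_no_neighbour[OF C u] by blast
  note sub = exclusive_large_if_no_neighbour(1)[OF C u u_no]
  have "N u \<inter> N c \<noteq> {}" using exclusive_common_ge(1)[OF C u] t_pos by auto
  then obtain w where w: "E u w" "w \<in> exclusive c e a" using sub by fastforce
  then have w': "w \<in> exclusive c a e" using exclusive_commute by metis
  have "N w \<inter> N e \<inter> N b \<noteq> {}"
    using exclusive_large_if_no_neighbour(2)[OF five_cycle_reflect[OF C'], of w] w small_e
      exclusive_commute by fastforce
  then have w_no: "N w \<inter> N a \<inter> N d = {}" using exclusive_no_neighbour[OF C' w'] by blast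
  \<comment> \<open>In the hexagon \<open>u a e d c w\<close> these are the six pairs at distance
    two and the opposite pairs \<open>ud\<close> and \<open>we\<close>. Two of them contain an edge
    of the hexagon, unless both lie in \<open>{u, c, e}\<close> or both in \<open>{w, a, d}\<close>;
    there \<open>u_no\<close> and \<open>w_no\<close> apply.\<close>
  let ?Ss = "[N c \<inter> N e, N d \<inter> N a, N u \<inter> N e, N w \<inter> N e, N u \<inter> N d, N w \<inter> N d, N u \<inter> N c, N w \<inter> N a]"
  have E: "E a b" "E b c" "E c d" "E d e" "E e a" "E b a" "E c b" "E d c" "E e d" "E a e"
    "E a u" "E u a" "E u w" "E w u" "E c w" "E w c"
    using C u w E_sym unfolding five_cycle_def exclusive_iff by auto
  have no: "\<And>z. E u z \<Longrightarrow> E c z \<Longrightarrow> E e z \<Longrightarrow> False" "\<And>z. E w z \<Longrightarrow> E a z \<Longrightarrow> E d z \<Longrightarrow> False"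
    using u_no w_no by auto
  have disj: "sorted_wrt disjnt ?Ss"
    by (auto simp: disjnt_iff dest: E[THEN no_triangle] no)
  have "t \<le> card (N c \<inter> N e)" "t \<le> card (N d \<inter> N a)"
    using five_cycle_common_ge C five_cycle_rotate by blast+
  then show False
    using exclusive_common_ge[OF C u] exclusive_common_ge[OF C' w'] N_subset
    by (intro no_eight_disjoint_large_sets[OF disj]) auto
qed

text \<open>A member would make the class at \<open>c\<close> or \<open>d\<close> large. A large
  class at \<open>c\<close> forces another at \<open>e\<close> or \<open>a\<close>, both at distance
  two from \<open>c\<close>, which is impossible; \<open>d\<close> is the mirror case.\<close>

lemma exclusive_empty:
  assumes C: "five_cycle a b c d e" shows "exclusive a c d = {}"
proof -
  have False if C: "five_cycle a b c d e" and large: "t \<le> card (exclusive c e a)" for a b c d e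
  proof -
    note C2 = five_cycle_rotate[OF five_cycle_rotate[OF C]]
    obtain u where "u \<in> exclusive c e a" using exclusive_nonempty[OF large] .
    then have "t \<le> card (exclusive e b c) \<or> t \<le> card (exclusive a c d)"
      by (rule exclusive_large_step[OF C2])
    then show False
      using not_two_exclusive_large[OF C _ large] not_two_exclusive_large[OF C2 large] by blast
  qed
  from this[OF C] this[OF five_cycle_reflect[OF C]] show ?thesis
    using exclusive_large_step[OF C] exclusive_commute by (metis equals0I)
qed

section \<open>The homomorphism given by a five-cycle\<close>

lemma five_cycle_sees_two:
  assumes C: "five_cycle a b c d e" and z: "z \<in> pverts G"
  shows "z \<in> N e \<inter> N b \<or> z \<in> N a \<inter> N c \<or> z \<in> N b \<inter> N d \<or> z \<in> N c \<inter> N e \<or> z \<in> N d \<inter> N a"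
proof (rule ccontr)
  assume none: "\<not> ?thesis"
  note C1 = five_cycle_rotate[OF C]
  note C2 = five_cycle_rotate[OF C1]
  note C3 = five_cycle_rotate[OF C2]
  note C4 = five_cycle_rotate[OF C3]
  have sees_none: "\<not> E p y" if "five_cycle p q r s v" "\<not> E r y" "\<not> E s y" for p q r s v y
    using exclusive_empty[OF that(1)] that(2,3) exclusive_iff by blast
  \<comment> \<open>A vertex that sees one cycle vertex also sees one opposite to it, so
    \<open>none\<close> leaves \<open>z\<close> without neighbours on the cycle.\<close>
  have E: "\<not> E a z" "\<not> E b z" "\<not> E c z" "\<not> E d z" "\<not> E e z"
    using none sees_none[OF C, of z] sees_none[OF C1, of z] sees_none[OF C2, of z]
      sees_none[OF C3, of z] sees_none[OF C4, of z] unfolding Int_iff N_iff by argo+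
  have "z \<noteq> a" using C E unfolding five_cycle_def by auto
  then obtain x where x: "E a x" "E z x"
    using common_neighbour[of a z] C z E E_verts unfolding five_cycle_def by metis
  \<comment> \<open>Replacing \<open>q\<close> by \<open>x\<close> gives a five-cycle on which
    \<open>z\<close> sees only \<open>x\<close>.\<close>
  have exchange: False if "five_cycle p q r s v" "E p x" "E r x" "\<not> E s z" "\<not> E v z"
    for p q r s v
  proof -
    have "five_cycle x r s v p" using that E_sym unfolding five_cycle_def by auto
    from exclusive_empty[OF this] show False
      using E_sym[OF x(2)] that(4,5) exclusive_iff by blast
  qed
  have "x \<in> N a \<inter> N c \<or> x \<in> N d \<inter> N a"
    using x(1) sees_none[OF C, of x] by auto
  then show False
    using exchange[OF C] exchange[OF five_cycle_reflect[OF C]] E by auto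
qed

lemma homomorphic_cycle_graph_5: "homomorphic G (cycle_graph 5)"
proof (cases "bipartite_graph G")
  case False
  then obtain a b c d e where C: "five_cycle a b c d e" by (rule bipartite_or_five_cycle)
  \<comment> \<open>A vertex goes to the position of the cycle vertex whose two cycle neighbours it
    sees.\<close>
  define \<sigma> :: "'a \<Rightarrow> nat" where "\<sigma> z = (if z \<in> N e \<inter> N b then 0 else if z \<in> N a \<inter> N c then 1
    else if z \<in> N b \<inter> N d then 2 else if z \<in> N c \<inter> N e then 3 else 4)" for z
  have cases: "\<sigma> z = 0 \<and> E e z \<and> E b z \<or> \<sigma> z = 1 \<and> E a z \<and> E c z \<or> \<sigma> z = 2 \<and> E b z \<and> E d z
      \<or> \<sigma> z = 3 \<and> E c z \<and> E e z \<or> \<sigma> z = 4 \<and> E d z \<and> E a z" if "z \<in> pverts G" for z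
    using five_cycle_sees_two[OF C that] unfolding \<sigma>_def by auto
  have "(\<sigma> x, \<sigma> y) \<in> parcs (cycle_graph 5)" if xy: "E x y" for x y
  proof -
    \<comment> \<open>Adjacent vertices see no common cycle vertex, and modulo 5 the sets
      \<open>{i-1, i+1}\<close> and \<open>{j-1, j+1}\<close> are disjoint only if \<open>i\<close>
      and \<open>j\<close> differ by 1.\<close>
    have "\<And>v. \<not> (E v x \<and> E v y)" using xy no_triangle by blast
    then show ?thesis
      using cases[OF E_verts(1)[OF xy]] cases[OF E_verts(2)[OF xy]]
      by (elim disjE conjE) (auto simp: cycle_graph_def)
  qed
  moreover have "\<sigma> \<in> pverts G \<rightarrow> pverts (cycle_graph 5)"
    by (auto simp: \<sigma>_def cycle_graph_def)
  ultimately show ?thesis unfolding homomorphic_def by auto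
qed (rule homomorphic_cycle_graph_5_if_bipartite)

end

lemma common_degree_graphI:
  assumes "pair_graph G" "triangle_free G" "t \<le> min_common_degree G" "card (pverts G) < 8 * t"
  shows "common_degree_graph G t"
proof -
  interpret pair_graph G by fact
  have "finite (nonedges G)"
    by (rule finite_subset[of _ "pverts G \<times> pverts G"]) (auto simp: nonedges_def)
  then have "min_common_degree G \<le> card (neighbourhood G x \<inter> neighbourhood G y)"
    if "(x, y) \<in> nonedges G" for x y
    using that unfolding min_common_degree_def by (intro Min_le) force+
  then show ?thesis
    using assms by unfold_locales (auto intro: le_trans)
qed

theorem theorem1p4:
  fixes G :: "'a pair_pre_digraph" and n :: nat
  assumes "pair_graph G"
    and "card (pverts G) = n"
    and "triangle_free G"
  shows "(min_common_degree G > n div 5 \<and> n \<ge> 5 \<longrightarrow> bipartite_graph G) \<and>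
         (min_common_degree G > n div 8 \<and> n \<ge> 8 \<longrightarrow> homomorphic G (cycle_graph 5))"
proof (intro conjI impI)
  assume "min_common_degree G > n div 5 \<and> n \<ge> 5"
  \<comment> \<open>\<open>Suc (n div 5)\<close> is the least \<open>t\<close> with
    \<open>n < 5 * t\<close>, which implies \<open>n < 8 * t\<close>.\<close>
  then have "common_degree_graph G (Suc (n div 5))"
    using assms by (intro common_degree_graphI) auto
  then show "bipartite_graph G"
    by (rule common_degree_graph.bipartite_if_order_less) (use assms in auto)
next
  assume "min_common_degree G > n div 8 \<and> n \<ge> 8"
  then have "common_degree_graph G (Suc (n div 8))"
    using assms by (intro common_degree_graphI) auto
  then show "homomorphic G (cycle_graph 5)"
    by (rule common_degree_graph.homomorphic_cycle_graph_5)
qed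

end
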